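(* Let $k$ be an odd natural number, $\varepsilon>0$, and let $v_\pm,u_\pm$ be real constants with $v_\pm>0$ and $u_->u_+$. There exists a weak solution $(\widehat v,\widehat u)\in L^1_{loc}((-\infty,+\infty))\times C^2((-\infty,+\infty))$ of the boundary value problem $$\begin{cases}-\xi\widehat v_\xi+(\widehat v\widehat u^k)_\xi=0,\\ -\xi(\widehat v\widehat u)_\xi+(\widehat v\widehat u^{k+1})_\xi=\varepsilon\widehat u_{\xi\xi},\end{cases}\qquad (\widehat v(\pm\infty),\widehat u(\pm\infty))=(v_\pm,u_\pm).$$
   Context: Weak solution means that for all $\phi\in C_0^\infty(\mathbb{R})$, $$-\int\widehat v(\widehat u^k-\xi)\phi'\,d\xi+\int\widehat v\phi\,d\xi=0,\qquad -\int\widehat v(\widehat u^k-\xi)\widehat u\,\phi'\,d\xi+\int\widehat v\widehat u\,\phi\,d\xi=\varepsilon\int\widehat u''\phi\,d\xi .$$ The boundary conditions mean $\lim_{\xi\to\pm\infty}\widehat u(\xi)=u_\pm$ and $\lim_{\xi\to\pm\infty}\widehat v(\xi)=v_\pm$, where $\widehat v$ has a representative that is continuous outside a single point. *)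

theory Defs
  imports "HOL-Analysis.Analysis"
begin

text \<open>
  \<open>deriv\<close> is total, so every derivative of order below \<open>n\<close> is explicitly required to be
  differentiable everywhere.
\<close>

definition Ck :: "nat \<Rightarrow> (real \<Rightarrow> real) \<Rightarrow> bool" where
  "Ck n f \<longleftrightarrow>
     (\<forall>m<n. \<forall>x. (deriv ^^ m) f differentiable (at x)) \<and> continuous_on UNIV ((deriv ^^ n) f)"

definition test_function :: "(real \<Rightarrow> real) \<Rightarrow> bool" where
  "test_function \<phi> \<longleftrightarrow> (\<forall>n. Ck n \<phi>) \<and> compact (closure {x. \<phi> x \<noteq> 0})"

definition L1_loc :: "(real \<Rightarrow> real) \<Rightarrow> bool" where
  "L1_loc v \<longleftrightarrow> (\<forall>K. compact K \<longrightarrow> set_integrable lebesgue K v)"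

text \<open>
  Multiplying by a test function and integrating by parts uses
  \<open>-\<xi> v' + (v u\<^sup>k)' = (v (u\<^sup>k - \<xi>))' + v\<close>, and likewise with \<open>v u\<close> in place of \<open>v\<close>.
\<close>

definition weak_solution :: "nat \<Rightarrow> real \<Rightarrow> (real \<Rightarrow> real) \<Rightarrow> (real \<Rightarrow> real) \<Rightarrow> bool" where
  "weak_solution k \<epsilon> v u \<longleftrightarrow>
     (\<forall>\<phi>. test_function \<phi> \<longrightarrow>
        - (LINT \<xi>|lebesgue. v \<xi> * (u \<xi> ^ k - \<xi>) * deriv \<phi> \<xi>)
          + (LINT \<xi>|lebesgue. v \<xi> * \<phi> \<xi>) = 0 \<and>
        - (LINT \<xi>|lebesgue. v \<xi> * (u \<xi> ^ k - \<xi>) * u \<xi> * deriv \<phi> \<xi>)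
          + (LINT \<xi>|lebesgue. v \<xi> * u \<xi> * \<phi> \<xi>)
          = \<epsilon> * (LINT \<xi>|lebesgue. deriv (deriv u) \<xi> * \<phi> \<xi>))"

text \<open>
  An element of \<open>L\<^sup>1\<^sub>l\<^sub>o\<^sub>c\<close> is a class modulo null sets, so its limits at infinity are those of a
  representative \<open>w\<close> that is continuous away from one point.
\<close>

definition boundary_conditions ::
  "real \<Rightarrow> real \<Rightarrow> real \<Rightarrow> real \<Rightarrow> (real \<Rightarrow> real) \<Rightarrow> (real \<Rightarrow> real) \<Rightarrow> bool" where
  "boundary_conditions vm vp um up v u \<longleftrightarrow>
     (u \<longlongrightarrow> um) at_bot \<and> (u \<longlongrightarrow> up) at_top \<and>
     (\<exists>w p. (AE x in lebesgue. w x = v x) \<and> continuous_on (UNIV - {p}) w \<and>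
            (w \<longlongrightarrow> vm) at_bot \<and> (w \<longlongrightarrow> vp) at_top)"

end

theory Submission
  imports Defs "HOL-Real_Asymp.Real_Asymp"
begin

text \<open>
  Away from the point where \<open>u\<^sup>k = \<xi>\<close> the flux \<open>w = v (u\<^sup>k - \<xi>)\<close> satisfies \<open>w' = - v\<close>, so the
  first equation is \<open>w' = - w / (u\<^sup>k - \<xi>)\<close>, which together with the values of \<open>v\<close> at infinity
  determines \<open>w\<close> from \<open>u\<close> on both sides of the crossing; the second equation then reads
  \<open>\<epsilon> u'' = w u'\<close>. Solving the two problems in turn gives a map \<open>u \<mapsto> w \<mapsto> T u\<close> on the nonincreasing
  functions with values in \<open>[u\<^sub>+, u\<^sub>-]\<close>. Both steps preserve the pointwise order, so \<open>T\<close> has a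
  fixed point by Knaster and Tarski, without any continuity or compactness of \<open>T\<close>. A fixed point
  is \<open>C\<^sup>1\<close>, hence \<open>w\<close> tends to \<open>0\<close> at the crossing; then \<open>w\<close> is continuous, \<open>u\<close> is \<open>C\<^sup>2\<close>, and
  the weak equations follow from the fundamental theorem of calculus with one exceptional point.
\<close>

subsection \<open>Integrals over half-lines\<close>

lemma set_integral_atLeast_split:
  fixes f :: "real \<Rightarrow> real"
  assumes "set_integrable lborel {a..} f" "a \<le> x"
  shows "(LBINT s:{a..}. f s) = integral {a..x} f + (LBINT s:{x..}. f s)"
proof -
  have i: "set_integrable lborel {a..x} f" "set_integrable lborel {x..} f"
    by (rule set_integrable_subset[OF assms(1)]; use assms(2) in auto)+
  have "{a..} = {a..x} \<union> {x..}" using assms(2) by auto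
  moreover have "AE s in lborel. \<not> (s \<in> {a..x} \<and> s \<in> {x..})"
    using AE_lborel_singleton[of x] by eventually_elim auto
  ultimately have "(LBINT s:{a..}. f s) = (LBINT s:{a..x}. f s) + (LBINT s:{x..}. f s)"
    using i by (simp add: set_integral_Un_AE)
  then show ?thesis using set_borel_integral_eq_integral(2)[OF i(1)] by simp
qed

lemma set_integral_atLeast_has_real_derivative:
  fixes f :: "real \<Rightarrow> real"
  assumes i: "set_integrable lborel {a..} f" and c: "continuous_on {a..} f" and x: "a < x"
  shows "((\<lambda>x. LBINT s:{x..}. f s) has_real_derivative - f x) (at x)"
proof -
  have "((\<lambda>y. integral {a..y} f) has_real_derivative f x) (at x within {a..x+1})"
    by (rule integral_has_real_derivative) (use x c in \<open>auto intro: continuous_on_subset\<close>)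
  then have "((\<lambda>y. integral {a..y} f) has_real_derivative f x) (at x)"
    using x by (simp add: at_within_Icc_at)
  then have "((\<lambda>y. (LBINT s:{a..}. f s) - integral {a..y} f) has_real_derivative - f x) (at x)"
    using DERIV_diff[OF DERIV_const, of _ _ x UNIV "LBINT s:{a..}. f s"] by simp
  then show ?thesis
  proof (rule has_field_derivative_transform_within_open[of _ _ _ "{a<..}"])
    fix y assume "y \<in> {a<..}"
    then show "(LBINT s:{a..}. f s) - integral {a..y} f = (LBINT s:{y..}. f s)"
      using set_integral_atLeast_split[OF i, of y] by simp
  qed (use x in auto)
qed

lemma set_integral_atLeast_tendsto_0:
  fixes f :: "real \<Rightarrow> real"
  assumes i: "set_integrable lborel {a..} f"
  shows "((\<lambda>x. LBINT s:{x..}. f s) \<longlongrightarrow> 0) at_top"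
proof -
  have "((\<lambda>b. LBINT s:{a..b}. f s) \<longlongrightarrow> (LBINT s:{a..}. f s)) at_top"
    by (rule tendsto_set_lebesgue_integral_at_top) (use i in auto)
  then have "((\<lambda>b. (LBINT s:{a..}. f s) - (LBINT s:{a..b}. f s)) \<longlongrightarrow> 0) at_top"
    by (auto intro!: tendsto_eq_intros)
  then show ?thesis
  proof (rule Lim_transform_eventually)
    show "\<forall>\<^sub>F x in at_top. (LBINT s:{a..}. f s) - (LBINT s:{a..x}. f s) = (LBINT s:{x..}. f s)"
      using eventually_ge_at_top[of a]
    proof eventually_elim
      case (elim x)
      have "set_integrable lborel {a..x} f"
        by (rule set_integrable_subset[OF i]) auto
      then show ?case
        using set_integral_atLeast_split[OF i elim] set_borel_integral_eq_integral(2) by force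
    qed
  qed
qed

text \<open>The substitution s -> -s reduces this to the convergence of integrals over
  \<open>{..y}\<close> as y tends to infinity.\<close>

lemma set_integral_atLeast_tendsto_integral:
  fixes f :: "real \<Rightarrow> real"
  assumes i: "integrable lborel f"
  shows "((\<lambda>x. LBINT s:{x..}. f s) \<longlongrightarrow> (LBINT s. f s)) at_bot"
proof -
  have "((\<lambda>y. \<integral> x. indicator {.. y} x *\<^sub>R f (- x) \<partial>lborel) \<longlongrightarrow> (\<integral> x. f (- x) \<partial>lborel)) at_top"
    by (rule tendsto_integral_at_top)
       (use lborel_integrable_real_affine[OF i, of "-1" 0] in auto)
  moreover have "(\<integral> x. f (- x) \<partial>lborel) = (\<integral> x. f x \<partial>lborel)"
    using lborel_integral_real_affine[of "-1" f 0] by simp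
  moreover have "(\<integral> x. indicator {.. y} x *\<^sub>R f (- x) \<partial>lborel) = (LBINT s:{-y..}. f s)" for y
    using lborel_integral_real_affine[of "-1" "\<lambda>x. indicator {-y..} x *\<^sub>R f x" 0]
    by (simp add: set_lebesgue_integral_def indicator_def)
  ultimately have "((\<lambda>y. LBINT s:{-y..}. f s) \<longlongrightarrow> (LBINT s. f s)) at_top"
    by simp
  then show ?thesis
    by (subst at_bot_mirror) (simp add: filterlim_filtermap)
qed

subsection \<open>The flux on one side of the crossing\<close>

text \<open>
  The solution of \<open>z' = z / (x - H x)\<close> with \<open>z / x \<longrightarrow> a\<close> at infinity, where \<open>H x < x\<close>. Comparing with
  \<open>1 / (s - c)\<close>, for a lower bound \<open>c\<close> of \<open>H\<close>, makes the integral converge.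
\<close>

definition outflow :: "real \<Rightarrow> real \<Rightarrow> (real \<Rightarrow> real) \<Rightarrow> real \<Rightarrow> real" where
  "outflow c a H x = a * (x - c) * exp (- (LBINT s:{x..}. 1 / (s - H s) - 1 / (s - c)))"

text \<open>Supplies the majorant for the integral in \<open>outflow\<close>; the antiderivative is
  a multiple of -1 / (s - b).\<close>

lemma set_integrable_inverse_square:
  fixes b x :: real
  assumes "b < x"
  shows "set_integrable lborel {x..} (\<lambda>s. C / (s - b)\<^sup>2)"
proof -
  have "set_integrable lborel (einterval x \<infinity>) (\<lambda>s. 1 / (s - b)\<^sup>2)"
  proof (rule interval_integral_FTC_nonneg(1)[where F = "\<lambda>s. - 1 / (s - b)"])
    show "DERIV (\<lambda>s. - 1 / (s - b)) s :> 1 / (s - b)\<^sup>2" if "ereal x < ereal s" for s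
      using that assms by (auto intro!: derivative_eq_intros simp: power2_eq_square)
    show "isCont (\<lambda>s. 1 / (s - b)\<^sup>2) s" if "ereal x < ereal s" for s
      using that assms by (auto intro!: continuous_intros)
    show "(((\<lambda>s. - 1 / (s - b)) \<circ> real_of_ereal) \<longlongrightarrow> - 1 / (x - b)) (at_right (ereal x))"
      unfolding ereal_tendsto_simps using assms by (auto intro!: tendsto_intros)
    have "((\<lambda>s. - 1 / (s - b)) \<longlongrightarrow> 0) at_top"
      by real_asymp
    then show "(((\<lambda>s. - 1 / (s - b)) \<circ> real_of_ereal) \<longlongrightarrow> 0) (at_left \<infinity>)"
      unfolding ereal_tendsto_simps by (simp add: comp_def)
  qed auto
  then have "set_integrable lborel {x<..} (\<lambda>s. C * (1 / (s - b)\<^sup>2))"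
    by (intro set_integrable_mult_right) auto
  then show ?thesis
    by (simp add: set_integrable_def) (rule integrable_cong_AE_imp, assumption, measurable,
      use AE_lborel_singleton[of x] in \<open>eventually_elim, auto simp: indicator_def\<close>)
qed

context
  fixes c a :: real and H :: "real \<Rightarrow> real"
  assumes anti: "antimono H" and gt: "\<And>x. c < H x" and a: "a > 0"
begin

text \<open>Past x the antitone H stays below H x. The upper bound first raises H s to H x, which
  leaves (H x - c) / ((s - H x) * (s - c)), and then shrinks s - c to s - H x. The integrand
  therefore decays like an inverse square.\<close>

lemma outflow_integrand:
  assumes "H x < x" "x \<le> s"
  shows "H s < s" "c < s" "0 \<le> 1 / (s - H s) - 1 / (s - c)"
    "1 / (s - H s) - 1 / (s - c) \<le> (H x - c) / (s - H x)\<^sup>2"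
proof -
  have "H s \<le> H x" using antimonoD[OF anti assms(2)] .
  then show 1: "H s < s" "c < s" using assms gt[of s] gt[of x] by auto
  show "0 \<le> 1 / (s - H s) - 1 / (s - c)"
    using 1 gt[of s] by (simp add: frac_le)
  have "1 / (s - H s) - 1 / (s - c) \<le> 1 / (s - H x) - 1 / (s - c)"
    using 1 \<open>H s \<le> H x\<close> assms by (simp add: frac_le)
  also have "\<dots> = (H x - c) / ((s - H x) * (s - c))"
    using 1 assms by (simp add: divide_simps)
  also have "\<dots> \<le> (H x - c) / ((s - H x) * (s - H x))"
    using 1 assms gt[of x] by (intro divide_left_mono mult_left_mono mult_pos_pos) auto
  finally show "1 / (s - H s) - 1 / (s - c) \<le> (H x - c) / (s - H x)\<^sup>2"
    by (simp add: power2_eq_square)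
qed

text \<open>Domination by the inverse square above. Measurability rests on monotonicity, since H may
  jump: the fixed-point argument ranges over all antitone velocities between two bounds.\<close>

lemma outflow_integrable:
  assumes "H x < x"
  shows "set_integrable lborel {x..} (\<lambda>s. 1 / (s - H s) - 1 / (s - c))"
proof -
  have "(\<lambda>s. - H s) \<in> borel_measurable borel"
    by (rule borel_measurable_mono) (use anti in \<open>auto simp: mono_def antimono_def\<close>)
  then have [measurable]: "H \<in> borel_measurable borel" by simp
  have "set_integrable lborel {x..} (\<lambda>s. (H x - c) / (s - H x)\<^sup>2)"
    by (rule set_integrable_inverse_square[OF assms])
  then show ?thesis
  proof (rule set_integrable_bound)
    show "AE s in lborel. s \<in> {x..} \<longrightarrow> norm (1 / (s - H s) - 1 / (s - c)) \<le> norm ((H x - c) / (s - H x)\<^sup>2)"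
    proof (rule AE_I2, intro impI)
      fix s assume "s \<in> {x..}"
      then have "x \<le> s" by simp
      from outflow_integrand(3,4)[OF assms this]
      show "norm (1 / (s - H s) - 1 / (s - c)) \<le> norm ((H x - c) / (s - H x)\<^sup>2)"
        unfolding real_norm_def by linarith
    qed
  qed (unfold set_borel_measurable_def, measurable)
qed

lemma outflow_pos: "H x < x \<Longrightarrow> 0 < outflow c a H x"
  using a outflow_integrand(2)[of x x] by (simp add: outflow_def)

text \<open>Moving x to the right increases the linear factor and removes a nonnegative piece from
  the integral in the negative exponent.\<close>

lemma outflow_mono:
  assumes "H x < x" "x \<le> y"
  shows "outflow c a H x \<le> outflow c a H y"
proof -
  note i = outflow_integrable[OF assms(1)]
  have "integral {x..y} (\<lambda>s. 1 / (s - H s) - 1 / (s - c)) \<ge> 0"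
    by (rule Henstock_Kurzweil_Integration.integral_nonneg,
        rule set_borel_integral_eq_integral(1), rule set_integrable_subset[OF i])
       (use outflow_integrand[OF assms(1)] in auto)
  then have "(LBINT s:{y..}. 1 / (s - H s) - 1 / (s - c)) \<le> (LBINT s:{x..}. 1 / (s - H s) - 1 / (s - c))"
    using set_integral_atLeast_split[OF i assms(2)] by linarith
  then show ?thesis
    unfolding outflow_def using a assms outflow_integrand(2)[OF assms(1), of x]
    by (intro mult_mono) auto
qed

lemma outflow_has_real_derivative:
  assumes c: "continuous_on UNIV H" and "H x < x"
  shows "(outflow c a H has_real_derivative outflow c a H x / (x - H x)) (at x)"
proof -
  \<comment> \<open>By continuity H t < t for some t slightly left of x, so that x is interior to a
    half-line on which the integrand is continuous and integrable.\<close>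
  have "(\<lambda>t. t - H t) \<midarrow>x\<rightarrow> x - H x"
    using c by (auto intro!: tendsto_intros simp: continuous_on_eq_continuous_at isCont_def)
  then have "\<forall>\<^sub>F t in at x. 0 < t - H t"
    by (rule order_tendstoD) (use assms in auto)
  then have "\<forall>\<^sub>F t in at_left x. 0 < t - H t"
    by (simp add: eventually_at_split)
  then have "\<forall>\<^sub>F t in at_left x. 0 < t - H t \<and> t < x"
    using eventually_at_left[of "x-1" x] by (auto simp: eventually_at_filter elim: eventually_mono)
  then obtain t where t: "H t < t" "t < x"
    by (metis (mono_tags, lifting) diff_gt_0_iff_gt eventually_happens trivial_limit_at_left_real)
  define J where "J = (\<lambda>x. LBINT s:{x..}. 1 / (s - H s) - 1 / (s - c))"
  have J: "(J has_real_derivative - (1 / (x - H x) - 1 / (x - c))) (at x)"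
    unfolding J_def
  proof (rule set_integral_atLeast_has_real_derivative[OF outflow_integrable[OF t(1)] _ t(2)])
    show "continuous_on {t..} (\<lambda>s. 1 / (s - H s) - 1 / (s - c))"
      using outflow_integrand(1,2)[OF t(1)]
      by (intro continuous_intros continuous_on_subset[OF c]) force+
  qed
  have "c < x" using outflow_integrand(2)[OF assms(2)] by simp
  have "((\<lambda>x. a * (x - c)) has_real_derivative a) (at x)"
    by (auto intro!: derivative_eq_intros)
  from DERIV_mult[OF this DERIV_fun_exp[OF DERIV_minus[OF J]]]
  have "((\<lambda>x. a * (x - c) * exp (- J x)) has_real_derivative
      a * exp (- J x) + exp (- J x) * - (- (1 / (x - H x) - 1 / (x - c))) * (a * (x - c))) (at x)" .
  moreover have "a * exp (- J x) + exp (- J x) * - (- (1 / (x - H x) - 1 / (x - c))) * (a * (x - c))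
      = a * exp (- J x) * (1 + (1 / (x - H x) - 1 / (x - c)) * (x - c))"
    by (simp only: minus_minus distrib_left mult_1_right mult_ac)
  \<comment> \<open>This is x - c times the logarithmic derivative 1 / (x - c) + (1 / (x - H x) - 1
    / (x - c)), in which the auxiliary c cancels.\<close>
  moreover have "1 + (1 / (x - H x) - 1 / (x - c)) * (x - c) = (x - c) / (x - H x)"
    using \<open>c < x\<close> by (simp add: left_diff_distrib)
  ultimately have "((\<lambda>x. a * (x - c) * exp (- J x)) has_real_derivative
      a * (x - c) * exp (- J x) / (x - H x)) (at x)"
    by (simp only: times_divide_eq_right mult_ac)
  then show ?thesis by (simp add: outflow_def[abs_def] J_def)
qed

text \<open>The exponential tends to 1 because its exponent is the tail of a convergent integral,
  and (x - c) / (x - H x) is squeezed between 1 and (x - c) / (x - M).\<close>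

lemma outflow_density_tendsto:
  assumes bd: "\<And>x. H x \<le> M"
  shows "((\<lambda>x. outflow c a H x / (x - H x)) \<longlongrightarrow> a) at_top"
proof -
  have "H (M + 1) < M + 1" using bd[of "M+1"] by simp
  from set_integral_atLeast_tendsto_0[OF outflow_integrable[OF this]]
  have 1: "((\<lambda>x. LBINT s:{x..}. 1 / (s - H s) - 1 / (s - c)) \<longlongrightarrow> 0) at_top" .
  have 2: "((\<lambda>x. (x - c) / (x - H x)) \<longlongrightarrow> 1) at_top"
  proof (rule tendsto_sandwich[of "\<lambda>_. 1" _ _ "\<lambda>x. (x - c) / (x - M)"])
    show "\<forall>\<^sub>F x in at_top. 1 \<le> (x - c) / (x - H x)"
      using eventually_gt_at_top[of M]
    proof eventually_elim
      case (elim x)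
      then show ?case using bd[of x] gt[of x] by (simp add: le_divide_eq)
    qed
    show "\<forall>\<^sub>F x in at_top. (x - c) / (x - H x) \<le> (x - c) / (x - M)"
      using eventually_gt_at_top[of M]
    proof eventually_elim
      case (elim x)
      then show ?case
        using bd[of x] gt[of x] by (intro divide_left_mono) (auto intro!: mult_pos_pos)
    qed
    show "((\<lambda>x. (x - c) / (x - M)) \<longlongrightarrow> 1) at_top" by real_asymp
  qed auto
  have "((\<lambda>x. a * ((x - c) / (x - H x)) * exp (- (LBINT s:{x..}. 1 / (s - H s) - 1 / (s - c)))) \<longlongrightarrow> a) at_top"
    by (rule tendsto_eq_intros 1 2 | simp)+
  then show ?thesis by (simp add: outflow_def)
qed

text \<open>Differentiability at the crossing bounds x - H x by a multiple of x - y. So 1 / (x - H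
  x), the logarithmic derivative of the outflow, is not integrable there, and the outflow is forced
  down to 0.\<close>

lemma outflow_tendsto_0:
  assumes c: "continuous_on UNIV H" and y: "H y = y" and d: "(H has_real_derivative D) (at y)"
  shows "(outflow c a H \<longlongrightarrow> 0) (at_right y)"
proof -
  \<comment> \<open>K is chosen positive with 1 - (D - 1) <= K: a difference quotient of H above D -
    1 then gives t - H t <= K * (t - y).\<close>
  define K where "K = \<bar>D\<bar> + 2"
  have K: "K > 0" by (simp add: K_def)
  have "((\<lambda>t. (H t - H y) / (t - y)) \<longlongrightarrow> D) (at y)"
    using d by (simp add: has_field_derivative_iff)
  then have "((\<lambda>t. (H t - H y) / (t - y)) \<longlongrightarrow> D) (at_right y)"
    by (rule filterlim_mono) (auto simp: at_within_le_nhds at_le)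
  then have "\<forall>\<^sub>F t in at_right y. (H t - H y) / (t - y) > D - 1"
    by (rule order_tendstoD) auto
  then obtain b where b: "b > y" "\<And>t. y < t \<Longrightarrow> t < b \<Longrightarrow> (H t - H y) / (t - y) > D - 1"
    by (auto simp: eventually_at_right_field)
  have lip: "t - H t \<le> K * (t - y)" if "y < t" "t < b" for t
  proof -
    have "H t - y > (D - 1) * (t - y)"
      using b(2)[OF that] that y by (simp add: less_divide_eq)
    moreover have "(1 - (D - 1)) * (t - y) \<le> K * (t - y)"
      using that by (intro mult_right_mono) (auto simp: K_def)
    ultimately show ?thesis by (simp add: algebra_simps)
  qed
  have neg: "H t < t" if "y < t" for t
    using antimonoD[OF anti, of y t] that y by simp
  define e where "e = (y + b) / 2"
  have e: "y < e" "e < b" using b by (auto simp: e_def)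
  \<comment> \<open>\<open>x - H x \<le> K (x - y)\<close> turns the equation for the outflow into a bound by a multiple of
    \<open>(x - y) powr (1 / K)\<close>.\<close>
  define f where "f t = ln (outflow c a H t) - ln (t - y) / K" for t
  have f: "f t \<le> f e" if "y < t" "t \<le> e" for t
  proof (rule DERIV_nonneg_imp_nondecreasing[OF that(2)])
    fix s assume s: "t \<le> s" "s \<le> e"
    then have s': "y < s" "s < b" using that e by auto
    have pos: "0 < outflow c a H s" by (rule outflow_pos[OF neg[OF s'(1)]])
    have "((\<lambda>t. ln (outflow c a H t)) has_real_derivative 1 / (s - H s)) (at s)"
      using DERIV_chain2[OF DERIV_ln_divide[OF pos] outflow_has_real_derivative[OF c neg[OF s'(1)]]] pos
      by simp
    moreover have "((\<lambda>t. ln (t - y) / K) has_real_derivative 1 / (K * (s - y))) (at s)"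
      using s' K by (auto intro!: derivative_eq_intros)
    ultimately have "(f has_real_derivative (1 / (s - H s) - 1 / (K * (s - y)))) (at s)"
      unfolding f_def by (rule DERIV_diff)
    moreover have "1 / (K * (s - y)) \<le> 1 / (s - H s)"
      using lip[OF s'] neg[OF s'(1)] by (simp add: frac_le)
    ultimately show "\<exists>D. (f has_real_derivative D) (at s) \<and> 0 \<le> D" by force
  qed
  have up: "outflow c a H t \<le> exp (f e) * (t - y) powr (1 / K)" if "y < t" "t \<le> e" for t
  proof -
    have "outflow c a H t = exp (f t + ln (t - y) / K)"
      using outflow_pos[OF neg[OF that(1)]] by (simp add: f_def)
    also have "\<dots> \<le> exp (f e + ln (t - y) / K)" using f[OF that] by simp
    also have "\<dots> = exp (f e) * (t - y) powr (1 / K)"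
      using that by (simp add: exp_add powr_def)
    finally show ?thesis .
  qed
  show ?thesis
  proof (rule tendsto_sandwich[of "\<lambda>_. 0"])
    show "\<forall>\<^sub>F t in at_right y. 0 \<le> outflow c a H t"
      unfolding eventually_at_right_field
      by (intro exI[of _ b]) (use b outflow_pos neg in \<open>auto simp: less_imp_le\<close>)
    show "\<forall>\<^sub>F t in at_right y. outflow c a H t \<le> exp (f e) * (t - y) powr (1 / K)"
      unfolding eventually_at_right_field by (intro exI[of _ e]) (use e up in auto)
    have "((\<lambda>t. (t - y) powr (1 / K)) \<longlongrightarrow> (y - y) powr (1 / K)) (at_right y)"
      by (rule tendsto_powr') (use K b in \<open>auto intro!: tendsto_eq_intros simp: eventually_at_right_field\<close>)
    then have "((\<lambda>t. exp (f e) * (t - y) powr (1 / K)) \<longlongrightarrow> exp (f e) * 0) (at_right y)"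
      using K by (intro tendsto_intros) simp
    then show "((\<lambda>t. exp (f e) * (t - y) powr (1 / K)) \<longlongrightarrow> 0) (at_right y)" by simp
  qed auto
qed

end

text \<open>A larger H has smaller gaps s - H s, hence a larger integral in the negative exponent.
  The common c makes the remaining factors equal.\<close>

lemma outflow_antimono:
  assumes "antimono H1" "antimono H2" "\<And>x. c < H1 x" "\<And>x. H1 x \<le> H2 x" "a > 0" "H2 x < x"
  shows "outflow c a H2 x \<le> outflow c a H1 x"
proof -
  have gt2: "c < H2 t" for t using assms(3,4)[of t] by simp
  have x1: "H1 x < x" using assms(4)[of x] assms(6) by simp
  have "(LBINT s:{x..}. 1 / (s - H1 s) - 1 / (s - c)) \<le> (LBINT s:{x..}. 1 / (s - H2 s) - 1 / (s - c))"
  proof (rule set_integral_mono)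
    show "set_integrable lborel {x..} (\<lambda>s. 1 / (s - H1 s) - 1 / (s - c))"
      by (rule outflow_integrable) (use assms x1 in auto)
    show "set_integrable lborel {x..} (\<lambda>s. 1 / (s - H2 s) - 1 / (s - c))"
      by (rule outflow_integrable) (use assms gt2 in auto)
    fix s assume "s \<in> {x..}"
    then have "H2 s < s" using antimonoD[OF assms(2), of x s] assms(6) by simp
    then show "1 / (s - H1 s) - 1 / (s - c) \<le> 1 / (s - H2 s) - 1 / (s - c)"
      using assms(4)[of s] by (simp add: frac_le)
  qed
  then show ?thesis
    unfolding outflow_def using assms(5) assms(3)[of x] x1 by (intro mult_left_mono) auto
qed

subsection \<open>The flux as a function of the velocity\<close>

text \<open>The half-turn of the graph about the origin preserves antitonicity and the diagonal
  while swapping the two sides of the crossing. Facts to the left of the crossing are obtained this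
  way from those to the right.\<close>

definition reflect :: "(real \<Rightarrow> real) \<Rightarrow> real \<Rightarrow> real" where
  "reflect H x = - H (- x)"

lemma reflect_reflect [simp]: "reflect (reflect H) = H"
  by (simp add: reflect_def fun_eq_iff)

lemma antimono_reflect: "antimono H \<Longrightarrow> antimono (reflect H)"
  by (simp add: antimono_def reflect_def)

text \<open>The flux is negative to the right of the crossing and positive to the left, where it is
  an outflow of the reflected problem. The shifts by 1 in \<open>m - 1\<close> and
  \<open>- M - 1\<close> turn the bounds on H into the strict lower bounds that
  \<open>outflow\<close> works with.\<close>

definition flux :: "real \<Rightarrow> real \<Rightarrow> real \<Rightarrow> real \<Rightarrow> (real \<Rightarrow> real) \<Rightarrow> real \<Rightarrow> real" where
  "flux vm vp m M H x =
     (if H x < x then - outflow (m - 1) vp H x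
      else if x < H x then outflow (- M - 1) vm (reflect H) (- x) else 0)"

lemma flux_reflect: "flux vp vm (- M) (- m) (reflect H) x = - flux vm vp m M H (- x)"
  by (auto simp: flux_def reflect_def[of H])

context
  fixes vm vp m M :: real and H :: "real \<Rightarrow> real"
  assumes pos: "vm > 0" "vp > 0" and anti: "antimono H" and bounds: "\<And>x. m \<le> H x" "\<And>x. H x \<le> M"
begin

lemma outflow_bounds: "m - 1 < H x" "- M - 1 < reflect H x"
  using bounds(1)[of x] bounds(2)[of "- x"] by (auto simp: reflect_def)

lemma flux_neg: "H x < x \<Longrightarrow> flux vm vp m M H x < 0"
  using outflow_pos[OF anti outflow_bounds(1) pos(2)] by (simp add: flux_def)

lemma flux_pos: "x < H x \<Longrightarrow> 0 < flux vm vp m M H x"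
  using outflow_pos[OF antimono_reflect[OF anti] outflow_bounds(2) pos(1), of "- x"]
  by (simp add: flux_def reflect_def[of H "- x"])

text \<open>On each side of the crossing \<open>outflow_mono\<close> applies; across it the signs
  decide.\<close>

lemma flux_antimono: "antimono (flux vm vp m M H)"
proof (rule antimonoI)
  fix x y :: real assume xy: "x \<le> y"
  then have H: "H y \<le> H x" by (rule antimonoD[OF anti])
  consider "H x < x" | "x \<le> H x" "H y < y" | "x \<le> H x" "H y = y" | "y < H y"
    by linarith
  then show "flux vm vp m M H y \<le> flux vm vp m M H x"
  proof cases
    case 1
    then show ?thesis
      using outflow_mono[OF anti outflow_bounds(1) pos(2) 1 xy] H xy by (simp add: flux_def)
  next
    case 2
    then show ?thesis
      using flux_neg[OF 2(2)] flux_pos[of x] by (cases "x = H x") (auto simp: flux_def[of _ _ _ _ _ x])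
  next
    case 3
    then show ?thesis
      using flux_pos[of x] by (cases "x = H x") (auto simp: flux_def)
  next
    case 4
    then have "reflect H (- y) < - y" by (simp add: reflect_def)
    from outflow_mono[OF antimono_reflect[OF anti] outflow_bounds(2) pos(1) this, of "- x"] 4 H xy
    show ?thesis by (simp add: flux_def)
  qed
qed

end

text \<open>If x lies on the same side of both graphs, two outflows are compared. Otherwise x lies
  between H1 x and H2 x, and 0 separates the fluxes.\<close>

lemma flux_mono:
  assumes pos: "vm > 0" "vp > 0" and "antimono H1" "antimono H2"
    and "\<And>x. m \<le> H1 x" "\<And>x. H1 x \<le> H2 x" "\<And>x. H2 x \<le> M"
  shows "flux vm vp m M H1 x \<le> flux vm vp m M H2 x"
proof -
  have b: "H1 t \<le> M" "m \<le> H2 t" for t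
    using assms(5-7)[of t] by linarith+
  consider "H2 x < x" | "x < H1 x" | "H1 x \<le> x" "x \<le> H2 x"
    by linarith
  then show ?thesis
  proof cases
    case 1
    have "outflow (m - 1) vp H2 x \<le> outflow (m - 1) vp H1 x"
      by (rule outflow_antimono)
         (use assms 1 outflow_bounds(1)[OF pos \<open>antimono H1\<close> assms(5) b(1)] in auto)
    then show ?thesis using 1 assms(6)[of x] by (simp add: flux_def)
  next
    case 2
    have "outflow (- M - 1) vm (reflect H1) (- x) \<le> outflow (- M - 1) vm (reflect H2) (- x)"
      by (rule outflow_antimono)
         (use assms 2 outflow_bounds(2)[OF pos \<open>antimono H2\<close> b(2) assms(7)] in
           \<open>auto simp: antimono_reflect reflect_def[of _ "- _"] simp: reflect_def\<close>)
    then show ?thesis using 2 assms(6)[of x] by (simp add: flux_def)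
  next
    case 3
    have "flux vm vp m M H1 x \<le> 0"
      using flux_neg[OF pos \<open>antimono H1\<close> assms(5) b(1), of x] 3
      by (cases "H1 x = x") (auto simp: flux_def)
    moreover have "0 \<le> flux vm vp m M H2 x"
      using flux_pos[OF pos \<open>antimono H2\<close> b(2) assms(7), of x] 3
      by (cases "H2 x = x") (auto simp: flux_def)
    ultimately show ?thesis by simp
  qed
qed

subsection \<open>The velocity as a function of the flux\<close>

text \<open>The antiderivative of w / \<epsilon> that vanishes at 0. The case split makes the
  integral signed, as \<open>integral\<close> over \<open>{0..x}\<close> is 0 for x < 0.\<close>

definition potential :: "real \<Rightarrow> (real \<Rightarrow> real) \<Rightarrow> real \<Rightarrow> real" where
  "potential \<epsilon> w x = (if 0 \<le> x then integral {0..x} w else - integral {x..0} w) / \<epsilon>"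

text \<open>The equation \<epsilon> u'' = w u' makes u' a multiple of
  \<open>exp (potential \<epsilon> w)\<close>; the normalisation gives u the limits um and
  up.\<close>

definition profile :: "real \<Rightarrow> real \<Rightarrow> real \<Rightarrow> (real \<Rightarrow> real) \<Rightarrow> real \<Rightarrow> real" where
  "profile \<epsilon> um up w x =
     up + (um - up) * ((LBINT s:{x..}. exp (potential \<epsilon> w s)) / (LBINT s. exp (potential \<epsilon> w s)))"

lemma integrable_antimono: "antimono w \<Longrightarrow> w integrable_on {a..b}" for w :: "real \<Rightarrow> real"
  using integrable_on_mono_on[of a b "\<lambda>x. - w x"] integrable_neg[of "\<lambda>x. - w x" "{a..b}"]
  by (auto simp: mono_on_def antimono_def)

lemma potential_diff:
  assumes "antimono w" "x \<le> y"
  shows "potential \<epsilon> w y - potential \<epsilon> w x = integral {x..y} w / \<epsilon>"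
proof -
  note i = Henstock_Kurzweil_Integration.integral_combine[OF _ _ integrable_antimono[OF assms(1)], symmetric]
  consider "0 \<le> x" | "x < 0" "0 \<le> y" | "y < 0" by linarith
  then show ?thesis
  proof cases
    case 1
    then show ?thesis using i[of 0 x y] assms(2) by (simp add: potential_def add_divide_distrib)
  next
    case 2
    then show ?thesis using i[of x 0 y] by (simp add: potential_def add_divide_distrib)
  next
    case 3
    then show ?thesis using i[of x y 0] assms(2)
      by (simp add: potential_def add_divide_distrib diff_divide_distrib)
  qed
qed

lemma continuous_on_potential:
  assumes "antimono w"
  shows "continuous_on A (potential \<epsilon> w)"
proof -
  have "isCont (potential \<epsilon> w) x" for x
  proof -
    have "continuous_on {x - 1..x + 1} (\<lambda>y. integral {x - 1..y} w * inverse \<epsilon> + potential \<epsilon> w (x - 1))"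
      by (intro continuous_on_add continuous_on_mult continuous_on_const
        indefinite_integral_continuous_1 integrable_antimono assms)
    then have "continuous_on {x - 1..x + 1} (potential \<epsilon> w)"
    proof (rule continuous_on_eq)
      fix y assume "y \<in> {x - 1..x + 1}"
      then show "integral {x - 1..y} w * inverse \<epsilon> + potential \<epsilon> w (x - 1) = potential \<epsilon> w y"
        using potential_diff[OF assms, of "x - 1" y \<epsilon>] by (simp add: divide_inverse)
    qed
    then show ?thesis by (rule continuous_on_interior) auto
  qed
  then show ?thesis by (intro continuous_at_imp_continuous_on) auto
qed

lemma potential_has_real_derivative:
  assumes w: "antimono w" and c: "continuous_on UNIV w"
  shows "(potential \<epsilon> w has_real_derivative w x / \<epsilon>) (at x)"
proof -
  have "((\<lambda>y. integral {x - 1..y} w) has_real_derivative w x) (at x within {x - 1..x + 1})"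
    by (rule integral_has_real_derivative) (auto intro: continuous_on_subset[OF c])
  then have "((\<lambda>y. integral {x - 1..y} w) has_real_derivative w x) (at x)"
    by (simp add: at_within_Icc_at)
  then have "((\<lambda>y. integral {x - 1..y} w / \<epsilon> + potential \<epsilon> w (x - 1)) has_real_derivative w x / \<epsilon>) (at x)"
    using DERIV_add[OF DERIV_cdivide DERIV_const, of _ "w x" x UNIV \<epsilon> "potential \<epsilon> w (x - 1)"] by simp
  then show ?thesis
    by (rule has_field_derivative_transform_within_open[of _ _ _ "{x - 1<..}"])
       (use potential_diff[OF w, of "x - 1" _ \<epsilon>, symmetric] in auto)
qed

lemma set_integrable_exp_decay:
  fixes f :: "real \<Rightarrow> real"
  assumes c: "continuous_on UNIV f" and d: "d > 0" and le: "\<And>x. b \<le> x \<Longrightarrow> \<bar>f x\<bar> \<le> C * exp (- d * x)"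
  shows "set_integrable lborel {b..} f"
proof -
  have "(\<lambda>x. exp (- d * x)) absolutely_integrable_on {b..}"
    by (rule nonnegative_absolutely_integrable_1)
       (use integrable_on_exp_minus_to_infinity[OF d] in auto)
  then have "set_integrable lborel {b..} (\<lambda>x. exp (- d * x))"
    unfolding set_integrable_def by (subst (asm) integrable_completion) auto
  then have "set_integrable lborel {b..} (\<lambda>x. C * exp (- d * x))"
    by (intro set_integrable_mult_right) auto
  then show ?thesis
  proof (rule set_integrable_bound)
    show "AE x in lborel. x \<in> {b..} \<longrightarrow> norm (f x) \<le> norm (C * exp (- d * x))"
      using order_trans[OF le abs_ge_self] by (intro AE_I2) simp
    have [measurable]: "f \<in> borel_measurable borel"
      by (rule borel_measurable_continuous_onI[OF c])
    show "set_borel_measurable lborel {b..} f"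
      unfolding set_borel_measurable_def by measurable
  qed
qed

text \<open>Beyond b the slope of the potential is at most w b / \<epsilon> < 0, and before a it is
  at least w a / \<epsilon> > 0. Both tails are thus dominated by decaying exponentials.\<close>

lemma integrable_exp_potential:
  assumes \<epsilon>: "\<epsilon> > 0" and w: "antimono w" and a: "w a > 0" and b: "w b < 0"
  shows "integrable lborel (\<lambda>s. exp (potential \<epsilon> w s))"
proof -
  let ?E = "\<lambda>s. exp (potential \<epsilon> w s)"
  have c: "continuous_on A ?E" for A
    by (intro continuous_intros continuous_on_potential w)
  have 1: "set_integrable lborel {b..} ?E"
  proof (rule set_integrable_exp_decay[OF c, of "- w b / \<epsilon>" _ "?E b * exp (- (w b / \<epsilon> * b))"])
    fix x assume x: "b \<le> x"
    have "integral {b..x} w \<le> integral {b..x} (\<lambda>_. w b)"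
      by (rule integral_le) (use w in \<open>auto intro: integrable_antimono dest: antimonoD\<close>)
    then have "integral {b..x} w / \<epsilon> \<le> w b * (x - b) / \<epsilon>"
      using x \<epsilon> by (intro divide_right_mono) (auto simp: mult.commute)
    then have "potential \<epsilon> w x \<le> potential \<epsilon> w b + w b * (x - b) / \<epsilon>"
      using potential_diff[OF w x, of \<epsilon>] by linarith
    also have "\<dots> = potential \<epsilon> w b + - (w b / \<epsilon> * b) + - (- w b / \<epsilon>) * x"
      by (simp add: algebra_simps diff_divide_distrib)
    finally have "?E x \<le> exp (potential \<epsilon> w b + - (w b / \<epsilon> * b) + - (- w b / \<epsilon>) * x)"
      by simp
    then show "\<bar>?E x\<bar> \<le> ?E b * exp (- (w b / \<epsilon> * b)) * exp (- (- w b / \<epsilon>) * x)"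
      by (simp only: exp_add abs_exp_cancel)
  qed (use \<epsilon> b in \<open>auto simp: divide_neg_pos\<close>)
  have 2: "set_integrable lborel {- a..} (\<lambda>s. ?E (- s))"
  proof (rule set_integrable_exp_decay[of _ "w a / \<epsilon>" _ "?E a * exp (- (w a / \<epsilon> * a))"])
    show "continuous_on UNIV (\<lambda>s. ?E (- s))"
      by (rule continuous_on_compose2[OF c[of UNIV]]) (auto intro: continuous_intros)
    fix x assume "- a \<le> x"
    then have x: "- x \<le> a" by simp
    have "integral {- x..a} (\<lambda>_. w a) \<le> integral {- x..a} w"
      by (rule integral_le) (use w in \<open>auto intro: integrable_antimono dest: antimonoD\<close>)
    then have "w a * (a + x) / \<epsilon> \<le> integral {- x..a} w / \<epsilon>"
      using x \<epsilon> by (intro divide_right_mono) (auto simp: mult.commute)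
    then have "potential \<epsilon> w (- x) \<le> potential \<epsilon> w a - w a * (a + x) / \<epsilon>"
      using potential_diff[OF w x, of \<epsilon>] by linarith
    also have "\<dots> = potential \<epsilon> w a + - (w a / \<epsilon> * a) + - (w a / \<epsilon>) * x"
      by (simp add: algebra_simps add_divide_distrib)
    finally have "?E (- x) \<le> exp (potential \<epsilon> w a + - (w a / \<epsilon> * a) + - (w a / \<epsilon>) * x)"
      by simp
    then show "\<bar>?E (- x)\<bar> \<le> ?E a * exp (- (w a / \<epsilon> * a)) * exp (- (w a / \<epsilon>) * x)"
      by (simp only: exp_add abs_exp_cancel)
  qed (use \<epsilon> a in auto)
  then have "integrable lborel (\<lambda>x. indicator {- a..} (0 + - 1 * x) *\<^sub>R ?E (- (0 + - 1 * x)))"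
    unfolding set_integrable_def by (rule lborel_integrable_real_affine) simp
  then have 3: "set_integrable lborel {..a} ?E"
    unfolding set_integrable_def
    by (rule back_subst[of "integrable lborel"]) (auto simp: fun_eq_iff indicator_def)
  have "set_integrable lborel {a..b} ?E"
    by (rule borel_integrable_atLeastAtMost')  (rule c)
  from set_integrable_Un[OF set_integrable_Un[OF 3 this] 1]
  have "set_integrable lborel ({..a} \<union> {a..b} \<union> {b..}) ?E" by simp
  moreover have "{..a} \<union> {a..b} \<union> {b..} = UNIV" by auto
  ultimately show ?thesis by (simp add: set_integrable_def)
qed

context
  fixes \<epsilon> um up a b :: real and w :: "real \<Rightarrow> real"
  assumes \<epsilon>: "\<epsilon> > 0" and w: "antimono w" and a: "w a > 0" and b: "w b < 0" and um: "up < um"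
begin

private abbreviation "E \<equiv> \<lambda>s. exp (potential \<epsilon> w s)"

lemma integrable_E: "integrable lborel E" "set_integrable lborel A E" if "A \<in> sets borel"
proof -
  show 1: "integrable lborel E"
    by (rule integrable_exp_potential[OF \<epsilon> w a b])
  have "set_integrable lborel UNIV E" using 1 by (simp add: set_integrable_def)
  then show "set_integrable lborel A E" by (rule set_integrable_subset) (use that in auto)
qed

lemma total_E_pos: "0 < (LBINT s. E s)"
proof -
  have "0 < (LBINT s. E s) \<longleftrightarrow> (LBINT s. E s) \<noteq> 0"
    by (simp add: less_le)
  also have "\<dots> \<longleftrightarrow> \<not> (AE s in lborel. E s = 0)"
    using integrable_E(1)[of UNIV] by (subst integral_nonneg_eq_0_iff_AE) auto
  also have "\<dots>" by (simp add: eventually_False ae_filter_eq_bot_iff)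
  finally show ?thesis .
qed

lemma profile_has_real_derivative:
  "(profile \<epsilon> um up w has_real_derivative - (um - up) * E x / (LBINT s. E s)) (at x)"
proof -
  have "((\<lambda>x. LBINT s:{x..}. E s) has_real_derivative - E x) (at x)"
    by (rule set_integral_atLeast_has_real_derivative[of "x - 1"])
       (auto intro!: integrable_E continuous_intros continuous_on_potential w)
  from DERIV_add[OF DERIV_const[of up] DERIV_cmult[OF DERIV_cdivide[OF this], of "um - up"]]
  show ?thesis
    unfolding profile_def[abs_def]
    by (rule DERIV_cong)
       (simp only: add_0_left mult_minus_left mult_minus_right times_divide_eq_right minus_divide_left)
qed

lemma profile_antimono: "antimono (profile \<epsilon> um up w)"
proof (rule antimonoI)
  fix x y :: real assume "x \<le> y"
  then show "profile \<epsilon> um up w y \<le> profile \<epsilon> um up w x"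
  proof (rule DERIV_nonpos_imp_nonincreasing)
    fix t
    have "- (um - up) * E t / (LBINT s. E s) \<le> 0"
      using um by (intro divide_nonpos_pos mult_nonpos_nonneg total_E_pos) auto
    then show "\<exists>D. (profile \<epsilon> um up w has_real_derivative D) (at t) \<and> D \<le> 0"
      using profile_has_real_derivative by blast
  qed
qed

lemma profile_at_top: "(profile \<epsilon> um up w \<longlongrightarrow> up) at_top"
proof -
  have "((\<lambda>x. LBINT s:{x..}. E s) \<longlongrightarrow> 0) at_top"
    by (rule set_integral_atLeast_tendsto_0[OF integrable_E(2)]) auto
  then show ?thesis
    unfolding profile_def[abs_def] using total_E_pos by (auto intro!: tendsto_eq_intros)
qed

lemma profile_at_bot: "(profile \<epsilon> um up w \<longlongrightarrow> um) at_bot"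
proof -
  have "((\<lambda>x. LBINT s:{x..}. E s) \<longlongrightarrow> (LBINT s. E s)) at_bot"
    by (rule set_integral_atLeast_tendsto_integral[OF integrable_E(1)]) auto
  then show ?thesis
    unfolding profile_def[abs_def] using total_E_pos by (auto intro!: tendsto_eq_intros)
qed

text \<open>An antitone function lies between its limits at the two infinities.\<close>

lemma profile_bounds: "up \<le> profile \<epsilon> um up w x" "profile \<epsilon> um up w x \<le> um"
proof -
  note mono = antimonoD[OF profile_antimono]
  have "\<forall>\<^sub>F y in at_top. profile \<epsilon> um up w y \<le> profile \<epsilon> um up w x"
    using eventually_ge_at_top[of x] by eventually_elim (rule mono)
  then show "up \<le> profile \<epsilon> um up w x"
    by (rule tendsto_upperbound[OF profile_at_top]) simp
  have "\<forall>\<^sub>F y in at_bot. profile \<epsilon> um up w x \<le> profile \<epsilon> um up w y"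
    using eventually_le_at_bot[of x] by eventually_elim (rule mono)
  then show "profile \<epsilon> um up w x \<le> um"
    by (rule tendsto_lowerbound[OF profile_at_bot]) simp
qed

end

text \<open>
  If \<open>w1 \<le> w2\<close> then \<open>exp (potential \<epsilon> w2) / exp (potential \<epsilon> w1)\<close> is nondecreasing, and a
  monotone likelihood ratio implies stochastic dominance.
\<close>

lemma profile_mono:
  assumes \<epsilon>: "\<epsilon> > 0" and w: "antimono w1" "antimono w2"
    and s1: "w1 a1 > 0" "w1 b1 < 0" and s2: "w2 a2 > 0" "w2 b2 < 0" and um: "up < um"
    and le: "\<And>x. w1 x \<le> w2 x"
  shows "profile \<epsilon> um up w1 x \<le> profile \<epsilon> um up w2 x"
proof -
  define E1 where "E1 = (\<lambda>s. exp (potential \<epsilon> w1 s))"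
  define E2 where "E2 = (\<lambda>s. exp (potential \<epsilon> w2 s))"
  \<comment> \<open>As the ratio E2 / E1 is nondecreasing, E2 >= r * E1 to the right of x and E2 <=
    r * E1 to the left; integration gives \<open>B\<close> and \<open>A\<close>.\<close>
  define r where "r = E2 x / E1 x"
  have i1: "set_integrable lborel A E1" if "A \<in> sets borel" for A
    unfolding E1_def by (rule integrable_E(2)[OF \<epsilon> w(1) s1 um that])
  have i2: "set_integrable lborel A E2" if "A \<in> sets borel" for A
    unfolding E2_def by (rule integrable_E(2)[OF \<epsilon> w(2) s2 um that])
  have ratio: "E2 s * E1 t \<le> E2 t * E1 s" if "s \<le> t" for s t
  proof -
    have "integral {s..t} w1 \<le> integral {s..t} w2"
      by (rule integral_le) (auto intro: integrable_antimono w le)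
    then have "integral {s..t} w1 / \<epsilon> \<le> integral {s..t} w2 / \<epsilon>"
      using \<epsilon> by (intro divide_right_mono) auto
    then have "potential \<epsilon> w2 s + potential \<epsilon> w1 t \<le> potential \<epsilon> w2 t + potential \<epsilon> w1 s"
      using potential_diff[OF w(1) that, of \<epsilon>] potential_diff[OF w(2) that, of \<epsilon>] by linarith
    then show ?thesis by (simp add: E1_def E2_def flip: exp_add)
  qed
  have E1: "E1 s > 0" for s by (simp add: E1_def)
  have split: "(LBINT s. f s) = (LBINT s:{..<x}. f s) + (LBINT s:{x..}. f s)"
    if "\<And>A. A \<in> sets borel \<Longrightarrow> set_integrable lborel A f" for f :: "real \<Rightarrow> real"
  proof -
    have "(LBINT s:{..<x} \<union> {x..}. f s) = (LBINT s:{..<x}. f s) + (LBINT s:{x..}. f s)"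
      by (rule set_integral_Un) (auto intro: that)
    moreover have "{..<x} \<union> {x..} = UNIV" by auto
    ultimately show ?thesis by (simp add: set_lebesgue_integral_def)
  qed
  define A1 where "A1 = (LBINT s:{..<x}. E1 s)"
  define B1 where "B1 = (LBINT s:{x..}. E1 s)"
  define A2 where "A2 = (LBINT s:{..<x}. E2 s)"
  define B2 where "B2 = (LBINT s:{x..}. E2 s)"
  have "(LBINT s:{x..}. r * E1 s) \<le> B2"
    unfolding B2_def
    by (rule set_integral_mono)
       (use i1 i2 ratio[of x] E1[of x] in \<open>auto intro!: set_integrable_mult_right simp: r_def field_simps\<close>)
  then have B: "r * B1 \<le> B2" by (simp add: B1_def)
  have "A2 \<le> (LBINT s:{..<x}. r * E1 s)"
    unfolding A2_def
    by (rule set_integral_mono)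
       (use i1 i2 ratio[of _ x] E1[of x] in \<open>auto intro!: set_integrable_mult_right simp: r_def field_simps\<close>)
  then have A: "A2 \<le> r * A1" by (simp add: A1_def)
  have nn: "0 \<le> A1" "0 \<le> B1"
    by (simp_all add: A1_def B1_def E1_def set_lebesgue_integral_def)
  have t: "(LBINT s. E1 s) = A1 + B1" "(LBINT s. E2 s) = A2 + B2"
    unfolding A1_def A2_def B1_def B2_def by (intro split i1 i2; assumption)+
  have tp: "0 < A1 + B1" "0 < A2 + B2"
    using total_E_pos[OF \<epsilon> w(1) s1 um] total_E_pos[OF \<epsilon> w(2) s2 um] t by (simp_all add: E1_def E2_def)
  have "B1 * A2 \<le> B1 * (r * A1)" using A nn by (intro mult_left_mono)
  also have "\<dots> = (r * B1) * A1" by simp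
  also have "\<dots> \<le> B2 * A1" using B nn by (intro mult_right_mono)
  \<comment> \<open>After cross-multiplication the common term B1 * B2 cancels and B1 * A2 <= B2 *
    A1 remains.\<close>
  finally have "B1 / (A1 + B1) \<le> B2 / (A2 + B2)"
    using tp by (simp add: divide_simps algebra_simps)
  then have "(um - up) * (B1 / (A1 + B1)) \<le> (um - up) * (B2 / (A2 + B2))"
    using um by (intro mult_left_mono) auto
  then show ?thesis
    using t by (simp add: profile_def E1_def E2_def B1_def B2_def)
qed

subsection \<open>The density for a differentiable velocity\<close>

text \<open>At a crossing this is 0 / 0 = 0, so that \<open>flow_density_mult\<close> holds at every
  point.\<close>

definition flow_density :: "real \<Rightarrow> real \<Rightarrow> real \<Rightarrow> real \<Rightarrow> (real \<Rightarrow> real) \<Rightarrow> real \<Rightarrow> real" where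
  "flow_density vm vp m M H x = flux vm vp m M H x / (H x - x)"

lemma flow_density_mult: "flow_density vm vp m M H x * (H x - x) = flux vm vp m M H x"
  by (auto simp: flow_density_def flux_def)

lemma flow_density_reflect: "flow_density vp vm (- M) (- m) (reflect H) x = flow_density vm vp m M H (- x)"
proof -
  have "- a / - b = a / b" for a b :: real by simp
  from this[of "flux vm vp m M H (- x)" "H (- x) + x"] show ?thesis
    by (simp add: flow_density_def flux_reflect) (simp add: reflect_def)
qed

section \<open>Flux and density seen from the right of the crossing\<close>

context
  fixes vm vp m M :: real and H :: "real \<Rightarrow> real"
  assumes pos: "vm > 0" "vp > 0" and anti: "antimono H" and bounds: "\<And>x. m \<le> H x" "\<And>x. H x \<le> M"
    and cont: "continuous_on UNIV H"
begin

lemma flux_has_real_derivative_right: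
  assumes "H x < x"
  shows "(flux vm vp m M H has_real_derivative - flow_density vm vp m M H x) (at x)"
proof -
  have "((\<lambda>x. - outflow (m - 1) vp H x) has_real_derivative - (outflow (m - 1) vp H x / (x - H x))) (at x)"
    by (rule DERIV_minus[OF outflow_has_real_derivative
          [OF anti outflow_bounds(1)[OF pos anti bounds] pos(2) cont assms]])
  also have "- (outflow (m - 1) vp H x / (x - H x)) = - flow_density vm vp m M H x"
    using assms by (simp add: flow_density_def flux_def) (metis minus_diff_eq minus_divide_right)
  finally have *: "((\<lambda>x. - outflow (m - 1) vp H x) has_real_derivative - flow_density vm vp m M H x) (at x)" .
  have "open {x. H x < x}"
    by (intro open_Collect_less continuous_on_id cont)
  from has_field_derivative_transform_within_open[OF * this] show ?thesis
    using assms by (simp add: flux_def)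
qed

lemma flow_density_nonneg: "0 \<le> flow_density vm vp m M H x"
proof -
  consider "H x < x" | "H x = x" | "x < H x" by linarith
  then show ?thesis
    using flux_neg[OF pos anti bounds, of x] flux_pos[OF pos anti bounds, of x]
    by cases (auto simp: flow_density_def divide_nonpos_neg)
qed

lemma flow_density_at_top: "(flow_density vm vp m M H \<longlongrightarrow> vp) at_top"
proof (rule Lim_transform_eventually)
  show "((\<lambda>x. outflow (m - 1) vp H x / (x - H x)) \<longlongrightarrow> vp) at_top"
    by (rule outflow_density_tendsto[OF anti outflow_bounds(1)[OF pos anti bounds] pos(2) bounds(2)])
  show "\<forall>\<^sub>F x in at_top. outflow (m - 1) vp H x / (x - H x) = flow_density vm vp m M H x"
    using eventually_gt_at_top[of M]
  proof eventually_elim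
    case (elim x)
    then have "H x < x" using bounds(2)[of x] by simp
    then show ?case by (simp add: flow_density_def flux_def) (metis minus_diff_eq minus_divide_right)
  qed
qed

lemma flux_tendsto_right:
  assumes "H y = y" "(H has_real_derivative D) (at y)"
  shows "(flux vm vp m M H \<longlongrightarrow> 0) (at_right y)"
proof (rule Lim_transform_eventually)
  show "((\<lambda>x. - outflow (m - 1) vp H x) \<longlongrightarrow> 0) (at_right y)"
    using tendsto_minus[OF outflow_tendsto_0[OF anti outflow_bounds(1)[OF pos anti bounds] pos(2) cont assms]]
    by simp
  have "- outflow (m - 1) vp H x = flux vm vp m M H x" if "y < x" for x
    using antimonoD[OF anti, of y x] that assms(1) by (simp add: flux_def)
  then show "\<forall>\<^sub>F x in at_right y. - outflow (m - 1) vp H x = flux vm vp m M H x"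
    unfolding eventually_at_right_field by (intro exI[of _ "y + 1"]) auto
qed

end

section \<open>Both sides of the crossing, by reflection\<close>

context
  fixes vm vp m M :: real and H :: "real \<Rightarrow> real"
  assumes pos: "vm > 0" "vp > 0" and anti: "antimono H" and bounds: "\<And>x. m \<le> H x" "\<And>x. H x \<le> M"
    and diff: "\<And>x. H differentiable (at x)"
begin

private lemma cont: "continuous_on UNIV H"
  using diff by (auto intro!: continuous_at_imp_continuous_on differentiable_imp_continuous_within)

private lemma reflected:
  "vp > 0" "vm > 0" "antimono (reflect H)" "- M \<le> reflect H x" "reflect H x \<le> - m"
  "continuous_on UNIV (reflect H)"
proof -
  show "continuous_on UNIV (reflect H)"
    unfolding reflect_def[abs_def]
    by (intro continuous_intros continuous_on_compose2[OF cont]) auto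
qed (use pos bounds antimono_reflect[OF anti] in \<open>auto simp: reflect_def\<close>)

lemma flux_has_real_derivative:
  assumes "H x \<noteq> x"
  shows "(flux vm vp m M H has_real_derivative - flow_density vm vp m M H x) (at x)"
proof (cases "H x < x")
  case True
  then show ?thesis by (rule flux_has_real_derivative_right[OF pos anti bounds cont])
next
  case False
  then have "reflect H (- x) < - x" using assms by (simp add: reflect_def)
  from flux_has_real_derivative_right[OF reflected this]
  have "(flux vp vm (- M) (- m) (reflect H) has_real_derivative - flow_density vm vp m M H x) (at (- x))"
    by (simp add: flow_density_reflect)
  then have "((\<lambda>t. - flux vp vm (- M) (- m) (reflect H) (- t)) has_real_derivative - flow_density vm vp m M H x) (at x)"
    using DERIV_minus[OF DERIV_chain2[of _ _ uminus x "-1" UNIV]] by (force intro: derivative_eq_intros)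
  then show ?thesis by (simp add: flux_reflect)
qed

text \<open>At a crossing both one-sided limits are 0, the left one by reflection. This continuity
  lifts u from C^1 to C^2 and carries the fundamental theorem of calculus through the
  crossing.\<close>

lemma isCont_flux: "isCont (flux vm vp m M H) x"
proof (cases "H x = x")
  case False
  then show ?thesis by (rule DERIV_isCont[OF flux_has_real_derivative])
next
  case True
  obtain D where D: "(H has_real_derivative D) (at x)"
    using diff[of x] by (auto simp: real_differentiable_def)
  have "(reflect H has_real_derivative D) (at (- x))"
    unfolding reflect_def[abs_def]
    using DERIV_minus[OF DERIV_chain2[of H D uminus "- x" "-1" UNIV]] D
    by (force intro: derivative_eq_intros)
  from flux_tendsto_right[OF reflected _ this] True
  have "(flux vp vm (- M) (- m) (reflect H) \<longlongrightarrow> 0) (at_right (- x))"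
    by (simp add: reflect_def)
  then have "((\<lambda>t. - flux vp vm (- M) (- m) (reflect H) (- t)) \<longlongrightarrow> - 0) (at_left x)"
    by (intro tendsto_minus) (simp add: at_left_minus[of x] filterlim_filtermap)
  then have "(flux vm vp m M H \<longlongrightarrow> 0) (at_left x)"
    by (simp add: flux_reflect)
  moreover have "(flux vm vp m M H \<longlongrightarrow> 0) (at_right x)"
    by (rule flux_tendsto_right[OF pos anti bounds cont True D])
  moreover have "flux vm vp m M H x = 0" using True by (simp add: flux_def)
  ultimately show ?thesis by (simp add: isCont_def filterlim_split_at)
qed

lemma flow_density_tendsto:
  "(flow_density vm vp m M H \<longlongrightarrow> vp) at_top" "(flow_density vm vp m M H \<longlongrightarrow> vm) at_bot"
proof -
  show "(flow_density vm vp m M H \<longlongrightarrow> vp) at_top"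
    by (rule flow_density_at_top[OF pos anti bounds cont])
  have "(flow_density vp vm (- M) (- m) (reflect H) \<longlongrightarrow> vm) at_top"
    by (rule flow_density_at_top[OF reflected])
  then show "(flow_density vm vp m M H \<longlongrightarrow> vm) at_bot"
    by (simp add: flow_density_reflect[abs_def] at_bot_mirror filterlim_filtermap)
qed

text \<open>For antitone H the difference H x - x is strictly decreasing and has at most one zero.
  If it has none, any p serves.\<close>

lemma crossing_unique: "\<exists>p. \<forall>x. x \<noteq> p \<longrightarrow> H x \<noteq> x"
proof (cases "\<exists>p. H p = p")
  case True
  then obtain p where "H p = p" by blast
  then have "H x \<noteq> x" if "x \<noteq> p" for x
    using that antimonoD[OF anti, of p x] antimonoD[OF anti, of x p] by linarith
  then show ?thesis by blast
qed auto

text \<open>The density may blow up at the crossing, but the negated flux is a continuous function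
  with this derivative elsewhere. Nonnegativity upgrades integrability to absolute
  integrability.\<close>

lemma flow_density_absolutely_integrable: "flow_density vm vp m M H absolutely_integrable_on {a..b}"
proof (cases "a \<le> b")
  case True
  obtain p where p: "\<And>x. x \<noteq> p \<Longrightarrow> H x \<noteq> x" using crossing_unique by blast
  have "(flow_density vm vp m M H has_integral (- flux vm vp m M H b - - flux vm vp m M H a)) {a..b}"
  proof (rule fundamental_theorem_of_calculus_interior_strong[of "{p}"])
    show "continuous_on {a..b} (\<lambda>x. - flux vm vp m M H x)"
      by (intro continuous_intros continuous_at_imp_continuous_on ballI isCont_flux)
    fix x assume "x \<in> {a<..<b} - {p}"
    then have "((\<lambda>x. - flux vm vp m M H x) has_real_derivative flow_density vm vp m M H x) (at x)"
      using DERIV_minus[OF flux_has_real_derivative[OF p, of x]] by simp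
    then show "((\<lambda>x. - flux vm vp m M H x) has_vector_derivative flow_density vm vp m M H x) (at x)"
      by (simp add: has_real_derivative_iff_has_vector_derivative)
  qed (use True in auto)
  then show ?thesis
    by (intro nonnegative_absolutely_integrable_1 flow_density_nonneg[OF pos anti bounds cont])
       (auto simp: integrable_on_def)
qed (auto simp: not_le)

lemma flow_density_L1_loc: "L1_loc (flow_density vm vp m M H)"
  unfolding L1_loc_def
proof (intro allI impI)
  fix K :: "real set" assume K: "compact K"
  then obtain R where "\<And>x. x \<in> K \<Longrightarrow> \<bar>x\<bar> \<le> R"
    using compact_imp_bounded[OF K] by (auto simp: bounded_real)
  then have "K \<subseteq> {- R..R}" by fastforce
  then show "set_integrable lebesgue K (flow_density vm vp m M H)"
    by (intro set_integrable_subset[OF flow_density_absolutely_integrable])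
       (use K in \<open>auto intro: lmeasurable_compact fmeasurableD\<close>)
qed

lemma flow_density_continuous_on: "\<exists>p. continuous_on (UNIV - {p}) (flow_density vm vp m M H)"
proof -
  obtain p where p: "\<And>x. x \<noteq> p \<Longrightarrow> H x \<noteq> x" using crossing_unique by blast
  have "continuous_on (UNIV - {p}) (flow_density vm vp m M H)"
    unfolding flow_density_def[abs_def]
    by (intro continuous_on_divide continuous_on_diff continuous_on_id continuous_at_imp_continuous_on
        ballI isCont_flux) (use p cont in \<open>auto simp: continuous_on_eq_continuous_at\<close>)
  then show ?thesis by blast
qed

end

subsection \<open>The weak equations\<close>

lemma test_function_support:
  assumes "test_function \<phi>"
  obtains R where "R > 0" "\<And>x. x \<notin> {- R..R} \<Longrightarrow> \<phi> x = 0 \<and> deriv \<phi> x = 0" "\<phi> R = 0" "\<phi> (- R) = 0"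
proof -
  have "bounded (closure {x. \<phi> x \<noteq> 0})"
    using assms by (auto simp: test_function_def intro: compact_imp_bounded)
  then have "bounded {x. \<phi> x \<noteq> 0}" using bounded_subset closure_subset by blast
  then obtain B where "B > 0" and B: "\<And>x. \<phi> x \<noteq> 0 \<Longrightarrow> \<bar>x\<bar> \<le> B"
    by (auto simp: bounded_pos)
  \<comment> \<open>Widening B to B + 1 makes \<phi> vanish at the endpoints too, where the boundary
    terms are evaluated. Outside the closed interval \<phi> is 0 on a neighbourhood, so its
    derivative is 0.\<close>
  have "deriv \<phi> x = 0" if "x \<notin> {- (B + 1)..B + 1}" for x
  proof -
    have "\<forall>\<^sub>F t in nhds x. t \<in> - {- (B + 1)..B + 1}"
      by (rule eventually_nhds_in_open) (use that in auto)
    then have "\<forall>\<^sub>F t in nhds x. \<phi> t = 0"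
      by eventually_elim (use B in force)
    then have "deriv \<phi> x = deriv (\<lambda>_. 0) x" by (rule deriv_cong_ev) simp
    then show ?thesis by simp
  qed
  moreover have "\<phi> x = 0" if "\<bar>x\<bar> > B" for x using B[of x] that by force
  ultimately show ?thesis using \<open>B > 0\<close> by (intro that[of "B + 1"]) auto
qed

lemma integrable_lebesgue_support:
  fixes f :: "real \<Rightarrow> real"
  assumes "f absolutely_integrable_on {- R..R}" "\<And>x. x \<notin> {- R..R} \<Longrightarrow> f x = 0"
  shows "integrable lebesgue f"
proof -
  have "(\<lambda>x. indicator {- R..R} x *\<^sub>R f x) = f"
    using assms(2) by (auto simp: fun_eq_iff indicator_def)
  then show ?thesis using assms(1) by (simp add: set_integrable_def)
qed

text \<open>Replaces integration by parts in the weak equations: F will be a flux times a test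
  function, and p the crossing, where F is known only to be continuous.\<close>

lemma lebesgue_integral_derivative_support:
  fixes F f :: "real \<Rightarrow> real"
  assumes i: "integrable lebesgue f" and z: "\<And>x. x \<notin> {- R..R} \<Longrightarrow> f x = 0" and R: "R > 0"
    and c: "\<And>x. isCont F x" and d: "\<And>x. x \<noteq> p \<Longrightarrow> (F has_real_derivative f x) (at x)"
    and F: "F R = 0" "F (- R) = 0"
  shows "(LINT x|lebesgue. f x) = 0"
proof -
  have "(f has_integral (F R - F (- R))) {- R..R}"
    by (rule fundamental_theorem_of_calculus_interior_strong[of "{p}"])
       (use R d c in \<open>auto simp flip: has_real_derivative_iff_has_vector_derivative
          intro: continuous_at_imp_continuous_on\<close>)
  then have "(f has_integral 0) UNIV"
    using has_integral_on_superset[of f 0 "{- R..R}" UNIV] F z by simp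
  moreover have "(f has_integral (LINT x|lebesgue. f x)) UNIV"
    by (rule has_integral_integral_lebesgue[OF i])
  ultimately show ?thesis by (rule has_integral_unique[symmetric])
qed

text \<open>With v (u^k - x) = w and w' = - v, the integrands are derivatives away from the
  crossing: v \<phi> - w \<phi>' = (- w \<phi>)', and v u \<phi> - w u \<phi>' - \<epsilon> u''
  \<phi> = (- w u \<phi>)' because \<epsilon> u'' = w u'. Compact support makes both integrals
  0.\<close>

lemma flow_density_weak_solution:
  fixes u :: "real \<Rightarrow> real" and vm vp m M \<epsilon> :: real and k :: nat
  defines "H \<equiv> \<lambda>x. u x ^ k"
  defines "w \<equiv> flux vm vp m M H"
  assumes pos: "vm > 0" "vp > 0" and anti: "antimono H" and bounds: "\<And>x. m \<le> H x" "\<And>x. H x \<le> M"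
    and u: "\<And>x. (u has_real_derivative deriv u x) (at x)" "continuous_on UNIV (deriv u)"
    and ode: "\<And>x. \<epsilon> * deriv (deriv u) x = w x * deriv u x"
    and u2: "continuous_on UNIV (deriv (deriv u))"
  shows "weak_solution k \<epsilon> (flow_density vm vp m M H) u"
  unfolding weak_solution_def
proof (intro allI impI)
  fix \<phi> assume \<phi>: "test_function \<phi>"
  have diff: "H differentiable (at x)" for x
    unfolding H_def real_differentiable_def using DERIV_power[OF u(1)] by blast
  define v where "v = flow_density vm vp m M H"
  note A = pos anti bounds diff
  have Ck1: "Ck 1 \<phi>" using \<phi> by (simp add: test_function_def)
  then have d\<phi>: "(\<phi> has_real_derivative deriv \<phi> x) (at x)" for x
    by (auto simp: Ck_def DERIV_deriv_iff_real_differentiable)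
  have c\<phi>: "isCont \<phi> x" for x by (rule DERIV_isCont[OF d\<phi>])
  have c\<phi>': "isCont (deriv \<phi>) x" for x
    using Ck1 by (simp add: Ck_def continuous_on_eq_continuous_at)
  have cu: "isCont u x" for x by (rule DERIV_isCont[OF u(1)])
  have cu2: "isCont (deriv (deriv u)) x" for x
    using u2 by (simp add: continuous_on_eq_continuous_at)
  have cw: "isCont w x" for x unfolding w_def by (rule isCont_flux[OF A])
  obtain R where R: "R > 0" "\<And>x. x \<notin> {- R..R} \<Longrightarrow> \<phi> x = 0 \<and> deriv \<phi> x = 0" "\<phi> R = 0" "\<phi> (- R) = 0"
    using test_function_support[OF \<phi>] by blast
  obtain p where p: "\<And>x. x \<noteq> p \<Longrightarrow> H x \<noteq> x"
    using crossing_unique[OF A] by blast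
  have dw: "(w has_real_derivative - v x) (at x)" if "x \<noteq> p" for x
    unfolding w_def v_def by (rule flux_has_real_derivative[OF A p[OF that]])
  have vw: "v x * (u x ^ k - x) = w x" for x
    using flow_density_mult[of vm vp m M H x] by (simp add: v_def w_def H_def)
  have int_cont: "integrable lebesgue g" if "\<And>x. isCont g x" "\<And>x. x \<notin> {- R..R} \<Longrightarrow> g x = 0"
    for g :: "real \<Rightarrow> real"
    using that by (intro integrable_lebesgue_support[where R = R] absolutely_integrable_continuous_real
        continuous_at_imp_continuous_on) auto
  \<comment> \<open>Since v may be unbounded, g * v is treated as a bounded measurable function
    times an absolutely integrable one.\<close>
  have int_v: "integrable lebesgue (\<lambda>x. g x * v x)" if "\<And>x. isCont g x" "\<And>x. x \<notin> {- R..R} \<Longrightarrow> g x = 0"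
    for g :: "real \<Rightarrow> real"
  proof (rule integrable_lebesgue_support)
    have g: "continuous_on {- R..R} g" using that(1) by (intro continuous_at_imp_continuous_on) auto
    show "(\<lambda>x. g x * v x) absolutely_integrable_on {- R..R}"
    proof (rule absolutely_integrable_bounded_measurable_product_real)
      show "g \<in> borel_measurable (lebesgue_on {- R..R})"
        by (rule continuous_imp_measurable_on_sets_lebesgue[OF g]) auto
      show "bounded (g ` {- R..R})"
        by (intro compact_imp_bounded compact_continuous_image g) auto
      show "v absolutely_integrable_on {- R..R}"
        unfolding v_def by (rule flow_density_absolutely_integrable[OF A])
    qed auto
  qed (use that in auto)

  have i1: "integrable lebesgue (\<lambda>x. w x * deriv \<phi> x)"
    by (rule int_cont) (use R in \<open>auto intro!: continuous_intros cw c\<phi>'\<close>)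
  have i2: "integrable lebesgue (\<lambda>x. v x * \<phi> x)"
    using int_v[of \<phi>] c\<phi> R(2) by (simp add: mult.commute)
  have "(LINT x|lebesgue. v x * \<phi> x - w x * deriv \<phi> x) = 0"
  proof (rule lebesgue_integral_derivative_support[where F = "\<lambda>x. - (w x * \<phi> x)" and R = R and p = p])
    show "((\<lambda>x. - (w x * \<phi> x)) has_real_derivative v x * \<phi> x - w x * deriv \<phi> x) (at x)" if "x \<noteq> p" for x
      using DERIV_minus[OF DERIV_mult[OF dw[OF that] d\<phi>[of x]]] by (simp add: algebra_simps)
  qed (use R i1 i2 in \<open>auto intro!: continuous_intros cw c\<phi>\<close>)
  then have 1: "- (LINT x|lebesgue. w x * deriv \<phi> x) + (LINT x|lebesgue. v x * \<phi> x) = 0"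
    using i1 i2 by simp

  have j1: "integrable lebesgue (\<lambda>x. w x * u x * deriv \<phi> x)"
    by (rule int_cont) (use R in \<open>auto intro!: continuous_intros cw cu c\<phi>'\<close>)
  have j2: "integrable lebesgue (\<lambda>x. v x * u x * \<phi> x)"
    using int_v[of "\<lambda>x. u x * \<phi> x"] c\<phi> cu R(2) by (simp add: mult_ac)
  have j3: "integrable lebesgue (\<lambda>x. \<epsilon> * (deriv (deriv u) x * \<phi> x))"
    by (rule int_cont) (use R in \<open>auto intro!: continuous_intros c\<phi> cu2\<close>)
  have "(LINT x|lebesgue. v x * u x * \<phi> x - w x * u x * deriv \<phi> x - \<epsilon> * (deriv (deriv u) x * \<phi> x)) = 0"
  proof (rule lebesgue_integral_derivative_support[where F = "\<lambda>x. - (w x * (u x * \<phi> x))" and R = R and p = p])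
    fix x assume "x \<noteq> p"
    have "- (- v x * (u x * \<phi> x) + (deriv u x * \<phi> x + deriv \<phi> x * u x) * w x)
        = v x * u x * \<phi> x - w x * u x * deriv \<phi> x - w x * deriv u x * \<phi> x"
      by (simp add: algebra_simps)
    also have "\<dots> = v x * u x * \<phi> x - w x * u x * deriv \<phi> x - \<epsilon> * (deriv (deriv u) x * \<phi> x)"
      by (simp add: ode[symmetric])
    finally have "- (- v x * (u x * \<phi> x) + (deriv u x * \<phi> x + deriv \<phi> x * u x) * w x)
        = v x * u x * \<phi> x - w x * u x * deriv \<phi> x - \<epsilon> * (deriv (deriv u) x * \<phi> x)" .
    from DERIV_cong[OF DERIV_minus[OF DERIV_mult[OF dw[OF \<open>x \<noteq> p\<close>] DERIV_mult[OF u(1)[of x] d\<phi>[of x]]]] this]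
    show "((\<lambda>x. - (w x * (u x * \<phi> x))) has_real_derivative
        v x * u x * \<phi> x - w x * u x * deriv \<phi> x - \<epsilon> * (deriv (deriv u) x * \<phi> x)) (at x)" .
  qed (use R j1 j2 j3 in \<open>auto intro!: continuous_intros cw c\<phi> cu\<close>)
  then have "(LINT x|lebesgue. v x * u x * \<phi> x) - (LINT x|lebesgue. w x * u x * deriv \<phi> x)
      - (LINT x|lebesgue. \<epsilon> * (deriv (deriv u) x * \<phi> x)) = 0"
    using Bochner_Integration.integral_diff[OF Bochner_Integration.integrable_diff[OF j2 j1] j3]
      Bochner_Integration.integral_diff[OF j2 j1] by linarith
  then have 2: "- (LINT x|lebesgue. w x * u x * deriv \<phi> x) + (LINT x|lebesgue. v x * u x * \<phi> x)
      = \<epsilon> * (LINT x|lebesgue. deriv (deriv u) x * \<phi> x)"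
    by (simp del: integral_mult_right_zero add: integral_mult_right_zero[symmetric])
  show "- (LINT \<xi>|lebesgue. flow_density vm vp m M H \<xi> * (u \<xi> ^ k - \<xi>) * deriv \<phi> \<xi>)
          + (LINT \<xi>|lebesgue. flow_density vm vp m M H \<xi> * \<phi> \<xi>) = 0 \<and>
        - (LINT \<xi>|lebesgue. flow_density vm vp m M H \<xi> * (u \<xi> ^ k - \<xi>) * u \<xi> * deriv \<phi> \<xi>)
          + (LINT \<xi>|lebesgue. flow_density vm vp m M H \<xi> * u \<xi> * \<phi> \<xi>)
          = \<epsilon> * (LINT \<xi>|lebesgue. deriv (deriv u) \<xi> * \<phi> \<xi>)"
    using 1 2 by (simp add: v_def[symmetric] vw)
qed

subsection \<open>Existence of a solution\<close>

text \<open>The Knaster-Tarski argument, with u the pointwise supremum of all v in S satisfying v <=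
  T v. Antitonicity and both bounds pass to suprema, so u stays in S; the constant l shows that such
  v exist.\<close>

lemma antimono_fixed_point:
  fixes T :: "(real \<Rightarrow> real) \<Rightarrow> real \<Rightarrow> real" and l r :: real
  assumes S_def: "S = {u. antimono u \<and> (\<forall>x. l \<le> u x \<and> u x \<le> r)}"
    and lr: "l \<le> r" and T: "\<And>u. u \<in> S \<Longrightarrow> T u \<in> S"
    and mono: "\<And>u v x. u \<in> S \<Longrightarrow> v \<in> S \<Longrightarrow> (\<And>y. u y \<le> v y) \<Longrightarrow> T u x \<le> T v x"
  shows "\<exists>u\<in>S. T u = u"
proof -
  define P where "P = {v \<in> S. \<forall>x. v x \<le> T v x}"
  define u where "u x = (SUP v\<in>P. v x)" for x
  have "(\<lambda>_. l) \<in> S" using lr by (auto simp: S_def antimono_def)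
  with T[OF this] have "(\<lambda>_. l) \<in> P" by (auto simp: P_def S_def)
  then have ne: "P \<noteq> {}" by auto
  have PS: "v \<in> S" if "v \<in> P" for v using that by (simp add: P_def)
  have upper: "v x \<le> u x" if "v \<in> P" for v x
    unfolding u_def by (rule cSUP_upper[OF that]) (use PS in \<open>auto simp: S_def intro!: bdd_aboveI2\<close>)
  have least: "u x \<le> y" if "\<And>v. v \<in> P \<Longrightarrow> v x \<le> y" for x y
    unfolding u_def by (rule cSUP_least[OF ne that])
  have uS: "u \<in> S"
  proof -
    have "antimono u"
    proof (rule antimonoI)
      fix x y :: real assume xy: "x \<le> y"
      show "u y \<le> u x"
      proof (rule least)
        fix v assume v: "v \<in> P"
        then have "v y \<le> v x" using PS[OF v] xy by (auto simp: S_def dest: antimonoD)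
        then show "v y \<le> u x" using upper[OF v, of x] by simp
      qed
    qed
    moreover have "u x \<le> r" for x by (rule least) (use PS in \<open>auto simp: S_def\<close>)
    moreover have "l \<le> u x" for x using upper[OF \<open>(\<lambda>_. l) \<in> P\<close>] .
    ultimately show ?thesis by (simp add: S_def)
  qed
  have le: "u x \<le> T u x" for x
  proof (rule least)
    fix v assume v: "v \<in> P"
    then have "v x \<le> T v x" by (simp add: P_def)
    also have "\<dots> \<le> T u x" by (rule mono[OF PS[OF v] uS]) (rule upper[OF v])
    finally show "v x \<le> T u x" .
  qed
  \<comment> \<open>Applying T to u <= T u puts T u into P, hence T u <= u as well.\<close>
  have "T u \<in> P" unfolding P_def using T[OF uS] mono[OF uS T[OF uS] le] by simp
  then have "T u x \<le> u x" for x by (rule upper)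
  with le have "T u = u" by (intro ext antisym)
  with uS show ?thesis by blast
qed

theorem theorem2p3:
  fixes k :: nat and \<epsilon> vm vp um up :: real
  assumes "odd k" and "\<epsilon> > 0" and "vm > 0" and "vp > 0" and "um > up"
  shows "\<exists>v u. L1_loc v \<and> Ck 2 u \<and> weak_solution k \<epsilon> v u \<and>
    boundary_conditions vm vp um up v u"
proof -
  define S where "S = {u :: real \<Rightarrow> real. antimono u \<and> (\<forall>x. up \<le> u x \<and> u x \<le> um)}"
  define W where "W u = flux vm vp (up ^ k) (um ^ k) (\<lambda>x. u x ^ k)" for u
  \<comment> \<open>Oddness of k makes the k-th power monotone on the whole line, negative
    velocities included.\<close>
  have pow: "antimono (\<lambda>x. u x ^ k)" "\<And>x. up ^ k \<le> u x ^ k" "\<And>x. u x ^ k \<le> um ^ k"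
    if "u \<in> S" for u
    using that \<open>odd k\<close> by (auto simp: S_def antimono_def intro: power_mono_odd)
  \<comment> \<open>The two points lie outside the range of u^k, strictly on either side of the
    crossing. The signs of the flux there make the exponential of the potential integrable.\<close>
  have W: "antimono (W u)" "W u (up ^ k - 1) > 0" "W u (um ^ k + 1) < 0" if "u \<in> S" for u
  proof -
    note P = assms(3,4) pow[OF that]
    show "antimono (W u)" unfolding W_def by (rule flux_antimono[OF P])
    show "W u (up ^ k - 1) > 0" unfolding W_def
      by (rule flux_pos[OF P]) (use pow(2)[OF that, of "up ^ k - 1"] in simp)
    show "W u (um ^ k + 1) < 0" unfolding W_def
      by (rule flux_neg[OF P]) (use pow(3)[OF that, of "um ^ k + 1"] in simp)
  qed
  have "\<exists>u\<in>S. profile \<epsilon> um up (W u) = u"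
  proof (rule antimono_fixed_point[OF S_def])
    show "up \<le> um" using assms by simp
    show "profile \<epsilon> um up (W u) \<in> S" if "u \<in> S" for u
      using profile_antimono[OF assms(2) W[OF that] assms(5)] profile_bounds[OF assms(2) W[OF that] assms(5)]
      by (simp add: S_def)
    show "profile \<epsilon> um up (W u) x \<le> profile \<epsilon> um up (W v) x"
      if uv: "u \<in> S" "v \<in> S" and le: "\<And>y. u y \<le> v y" for u v x
    proof (rule profile_mono[OF assms(2) W(1)[OF uv(1)] W(1)[OF uv(2)] W(2,3)[OF uv(1)] W(2,3)[OF uv(2)] assms(5)])
      show "W u y \<le> W v y" for y
        unfolding W_def
        by (rule flux_mono[OF assms(3,4) pow(1)[OF uv(1)] pow(1)[OF uv(2)] pow(2)[OF uv(1)] _ pow(3)[OF uv(2)]])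
           (use le \<open>odd k\<close> in \<open>auto intro: power_mono_odd\<close>)
    qed
  qed
  then obtain u where u: "u \<in> S" and uT: "profile \<epsilon> um up (W u) = u" by blast
  define w where "w = W u"
  define H where "H = (\<lambda>x. u x ^ k)"
  define v where "v = flow_density vm vp (up ^ k) (um ^ k) H"
  note w = W[OF u, folded w_def]
  define I where "I = (LINT s|lborel. exp (potential \<epsilon> w s))"
  \<comment> \<open>The fixed-point equation itself yields regularity: u is a profile, which is
    differentiable although w is so far known only to be antitone.\<close>
  have du: "(u has_real_derivative - (um - up) * exp (potential \<epsilon> w x) / I) (at x)" for x
    using profile_has_real_derivative[OF assms(2) w assms(5)] uT by (simp add: w_def I_def)
  then have deriv: "deriv u = (\<lambda>x. - (um - up) * exp (potential \<epsilon> w x) / I)"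
    by (auto simp: fun_eq_iff intro: DERIV_imp_deriv)
  have diff: "H differentiable (at x)" for x
    unfolding H_def real_differentiable_def using DERIV_power[OF du] by blast
  have "antimono H" "\<And>x. up ^ k \<le> H x" "\<And>x. H x \<le> um ^ k"
    using pow[OF u] by (simp_all add: H_def)
  note A = assms(3,4) this diff
  \<comment> \<open>Now that H is differentiable, w is continuous even at the crossing, so the
    formula for u' can be differentiated once more.\<close>
  have cw: "continuous_on UNIV w"
    unfolding w_def W_def H_def[symmetric]
    by (intro continuous_at_imp_continuous_on ballI isCont_flux[OF A])
  have du2: "(deriv u has_real_derivative w x / \<epsilon> * deriv u x) (at x)" for x
  proof -
    have "((\<lambda>x. exp (potential \<epsilon> w x)) has_real_derivative exp (potential \<epsilon> w x) * (w x / \<epsilon>)) (at x)"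
      by (rule DERIV_fun_exp[OF potential_has_real_derivative[OF w(1) cw]])
    from DERIV_cdivide[OF DERIV_cmult[OF this, of "- (um - up)"], of I] show ?thesis
      unfolding deriv by (rule DERIV_cong) simp
  qed
  then have deriv2: "deriv (deriv u) = (\<lambda>x. w x / \<epsilon> * deriv u x)"
    by (auto simp: fun_eq_iff intro: DERIV_imp_deriv)
  have cu': "continuous_on UNIV (deriv u)"
    by (intro continuous_at_imp_continuous_on ballI DERIV_isCont[OF du2])
  have cu'': "continuous_on UNIV (deriv (deriv u))"
    unfolding deriv2 using assms(2) by (intro continuous_intros cw cu') auto
  have "L1_loc v" unfolding v_def by (rule flow_density_L1_loc[OF A])
  moreover have "Ck 2 u"
    unfolding Ck_def
  proof (intro conjI allI impI)
    fix n x assume "n < (2 :: nat)"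
    then consider "n = 0" | "n = 1" by linarith
    then show "(deriv ^^ n) u differentiable (at x)"
      using du du2 by cases (auto simp: real_differentiable_def)
  next
    show "continuous_on UNIV ((deriv ^^ 2) u)"
      using cu'' by (simp add: numeral_2_eq_2)
  qed
  moreover have "weak_solution k \<epsilon> v u"
    unfolding v_def H_def
  proof (rule flow_density_weak_solution[OF assms(3,4) pow[OF u]])
    show "(u has_real_derivative deriv u x) (at x)" for x using du by (simp add: deriv)
    show "\<epsilon> * deriv (deriv u) x = flux vm vp (up ^ k) (um ^ k) (\<lambda>x. u x ^ k) x * deriv u x" for x
      using assms(2) by (simp add: deriv2 w_def W_def)
  qed (rule cu' cu'')+
  moreover have "boundary_conditions vm vp um up v u"
  proof -
    have "(u \<longlongrightarrow> um) at_bot" "(u \<longlongrightarrow> up) at_top"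
      using profile_at_bot[OF assms(2) w assms(5)] profile_at_top[OF assms(2) w assms(5)] uT
      by (simp_all add: w_def)
    \<comment> \<open>The density itself serves as the representative that is continuous away from
      one point.\<close>
    then show ?thesis
      unfolding boundary_conditions_def v_def
      using flow_density_tendsto[OF A] flow_density_continuous_on[OF A] by blast
  qed
  ultimately show ?thesis by blast
qed

end
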